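(* Let $X$ be an infinite dimensional separable complex Banach space. Then there exists a symmetric bihypercyclic continuous bilinear mapping $A:X\times X\to X$.
   Context: A bilinear mapping $A:X\times X\to X$ is symmetric if $A(x,y)=A(y,x)$ for all $x,y\in X$. For a continuous bilinear mapping $A:X\times X\to X$ and $x,y\in X$, define sets inductively by $A^0(x,y)=\{x,y\}$ and $A^n(x,y)=A^{n-1}(x,y)\cup\{A(z,w): z,w\in A^{n-1}(x,y)\}$ for $n\geq 1$. The mapping $A$ is called bihypercyclic if there exist $x,y\in X$ such that $\bigcup_{n\geq 0}A^n(x,y)$ is dense in $X$. *)

theory Defs
  imports "HOL-Analysis.Analysis"
begin

text \<open>
  The library's class \<open>banach\<close> consists of real Banach spaces.  A complex Banach space is a
  real one together with a complex scalar multiplication that extends the real one and for which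
  the norm is homogeneous.
\<close>

class complex_banach = banach +
  fixes scaleC :: "complex \<Rightarrow> 'a \<Rightarrow> 'a"  (infixr "*\<^sub>C" 75)
  assumes scaleC_add_right: "a *\<^sub>C (x + y) = a *\<^sub>C x + a *\<^sub>C y"
    and scaleC_add_left: "(a + b) *\<^sub>C x = a *\<^sub>C x + b *\<^sub>C x"
    and scaleC_scaleC: "a *\<^sub>C b *\<^sub>C x = (a * b) *\<^sub>C x"
    and scaleC_one: "1 *\<^sub>C x = x"
    and scaleC_of_real: "complex_of_real r *\<^sub>C x = r *\<^sub>R x"
    and norm_scaleC: "norm (a *\<^sub>C x) = cmod a * norm x"

lemma vector_space_scaleC: "vector_space (scaleC :: complex \<Rightarrow> 'a \<Rightarrow> 'a::complex_banach)"
  by unfold_locales (simp_all add: scaleC_add_right scaleC_add_left scaleC_scaleC scaleC_one)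

instantiation complex :: complex_banach
begin

definition scaleC_complex :: "complex \<Rightarrow> complex \<Rightarrow> complex" where
  "scaleC_complex a x = a * x"

instance
  by standard (simp_all add: scaleC_complex_def algebra_simps norm_mult scaleR_conv_of_real)

end

text \<open>
  The locale \<open>finite_dimensional_vector_space\<close> takes as its second parameter a finite basis.
\<close>

definition infinite_dimensional :: "'a::complex_banach itself \<Rightarrow> bool" where
  "infinite_dimensional _ \<longleftrightarrow>
     \<not> (\<exists>B :: 'a set. finite_dimensional_vector_space (scaleC :: complex \<Rightarrow> 'a \<Rightarrow> 'a) B)"

definition complex_bilinear :: "('a \<Rightarrow> 'a \<Rightarrow> 'a::complex_banach) \<Rightarrow> bool" where
  "complex_bilinear A \<longleftrightarrow>
     (\<forall>x. Vector_Spaces.linear scaleC scaleC (\<lambda>y. A x y)) \<and>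
     (\<forall>y. Vector_Spaces.linear scaleC scaleC (\<lambda>x. A x y))"

text \<open>\<open>bilinear_iterate A n x y\<close> is the set written $A^n(x,y)$.\<close>

primrec bilinear_iterate :: "('a \<Rightarrow> 'a \<Rightarrow> 'a) \<Rightarrow> nat \<Rightarrow> 'a \<Rightarrow> 'a \<Rightarrow> 'a set" where
  "bilinear_iterate A 0 x y = {x, y}"
| "bilinear_iterate A (Suc n) x y =
     bilinear_iterate A n x y \<union>
     {A z w | z w. z \<in> bilinear_iterate A n x y \<and> w \<in> bilinear_iterate A n x y}"

definition bihypercyclic :: "('a \<Rightarrow> 'a \<Rightarrow> 'a::complex_banach) \<Rightarrow> bool" where
  "bihypercyclic A \<longleftrightarrow> (\<exists>x y. closure (\<Union>n. bilinear_iterate A n x y) = UNIV)"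

end

theory Submission
  imports Defs
begin

text \<open>
  Fix a biorthogonal system \<open>(e\<^sub>n, f\<^sub>n)\<close> with dense span, available by Hahn--Banach.  Let
  \<open>S e\<^sub>n\<^sub>+\<^sub>2 = w\<^sub>n e\<^sub>n\<^sub>+\<^sub>1\<close> and \<open>S e\<^sub>0 = S e\<^sub>1 = 0\<close> with weights small enough for \<open>S\<close> to be
  bounded, and put \<open>R x = f\<^sub>1(x) e\<^sub>0 + S x\<close>.  The mapping
  \<open>A(x, z) = (f\<^sub>0(x) f\<^sub>0(z) + f\<^sub>1(x) f\<^sub>1(z)) e\<^sub>0 + f\<^sub>0(x) S z + f\<^sub>0(z) S x\<close> satisfies, for
  \<open>q = e\<^sub>0 + e\<^sub>1\<close> and \<open>u\<close> in the kernel of \<open>f\<^sub>0\<close>: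
  \<open>A(q, q) = 2 e\<^sub>0\<close>, \<open>A(c e\<^sub>0, c' e\<^sub>0) = c c' e\<^sub>0\<close>, \<open>A(c e\<^sub>0, u) = c S u\<close> and
  \<open>A(q, u) = R u\<close>.  Starting from \<open>q\<close> and \<open>y\<close> one therefore reaches all vectors
  \<open>2\<^sup>k R S\<^sup>n y\<close> with \<open>k \<ge> n \<ge> 1\<close>.  Because arbitrarily large powers of \<open>2\<close> are available, a
  backward shift with any weights will do, and a Baire category argument gives a \<open>y\<close> for which
  these vectors are dense.
\<close>

section \<open>Sublinear functionals and the Hahn--Banach theorem\<close>

definition sublinear :: "('a::real_vector \<Rightarrow> real) \<Rightarrow> bool" where
  "sublinear q \<longleftrightarrow> (\<forall>x y. q (x + y) \<le> q x + q y) \<and> (\<forall>t\<ge>0. \<forall>x. q (t *\<^sub>R x) = t * q x)"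

lemma sublinear_add: "sublinear q \<Longrightarrow> q (x + y) \<le> q x + q y"
  by (simp add: sublinear_def)

lemma sublinear_scaleR: "sublinear q \<Longrightarrow> t \<ge> 0 \<Longrightarrow> q (t *\<^sub>R x) = t * q x"
  by (simp add: sublinear_def)

lemma sublinear_0: "sublinear q \<Longrightarrow> q 0 = 0"
  using sublinear_scaleR[of q 0 0] by simp

lemma sublinear_minus: "sublinear q \<Longrightarrow> - q (- x) \<le> q x"
  using sublinear_add[of q x "- x"] sublinear_0[of q] by simp

text \<open>The inequality at \<open>inverse t\<close> and \<open>t *\<^sub>R x\<close> reverses the
  one at \<open>t\<close> and \<open>x\<close>, so scaling needs checking in one direction
  only.\<close>

lemma sublinearI:
  assumes "\<And>x y. q (x + y) \<le> q x + q y" and "q 0 = 0"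
    and le: "\<And>t x. t > 0 \<Longrightarrow> q (t *\<^sub>R x) \<le> t * q x"
  shows "sublinear q"
proof -
  have "q (t *\<^sub>R x) = t * q x" if "t > 0" for t x
    using le[OF that, of x] le[of "inverse t" "t *\<^sub>R x"] that by (simp add: field_simps)
  then have "q (t *\<^sub>R x) = t * q x" if "t \<ge> 0" for t x
    using that \<open>q 0 = 0\<close> by (cases "t = 0") auto
  with assms show ?thesis
    by (simp add: sublinear_def)
qed

text \<open>The functional is the infimum over \<open>t \<ge> 0\<close> of
  \<open>q (y + t *\<^sub>R x) - t * q x\<close>; at \<open>- x\<close> the choice
  \<open>t = 1\<close> gives the last bound. For minimal \<open>q\<close> this forces
  \<open>q (- x) = - q x\<close>; for \<open>q = norm\<close> and \<open>x \<noteq> 0\<close> it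
  keeps linear functionals below \<open>r\<close> from vanishing at \<open>x\<close>.\<close>

lemma sublinear_decrease:
  fixes q :: "'a::real_vector \<Rightarrow> real"
  assumes q: "sublinear q"
  obtains r where "sublinear r" "r \<le> q" "r (- x) \<le> - q x"
proof
  define r where "r y = (INF t\<in>{0..}. q (y + t *\<^sub>R x) - t * q x)" for y
  have bdd: "bdd_below ((\<lambda>t. q (y + t *\<^sub>R x) - t * q x) ` {0..})" for y
  proof (rule bdd_belowI2)
    fix t :: real assume "t \<in> {0..}"
    then have "t * q x = q ((y + t *\<^sub>R x) + (- y))"
      using sublinear_scaleR[OF q, of t x] by simp
    also have "\<dots> \<le> q (y + t *\<^sub>R x) + q (- y)"
      by (rule sublinear_add[OF q])
    finally show "- q (- y) \<le> q (y + t *\<^sub>R x) - t * q x" by simp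
  qed
  have upper: "r y \<le> q (y + t *\<^sub>R x) - t * q x" if "t \<ge> 0" for t y
    unfolding r_def by (rule cINF_lower[OF bdd]) (use that in auto)
  have lower: "c \<le> r y" if "\<And>t. t \<ge> 0 \<Longrightarrow> c \<le> q (y + t *\<^sub>R x) - t * q x" for c y
    unfolding r_def by (rule cINF_greatest) (use that in auto)
  show "r \<le> q"
    using upper[of 0] by (auto simp: le_fun_def)
  show "r (- x) \<le> - q x"
    using upper[of 1 "- x"] sublinear_0[OF q] by simp
  show "sublinear r"
  proof (rule sublinearI)
    fix y z
    \<comment> \<open>Parameters \<open>s\<close> for \<open>y\<close> and \<open>t\<close> for
      \<open>z\<close> combine to the parameter \<open>s + t\<close> for
      \<open>y + z\<close>.\<close>
    have "r (y + z) - (q (z + t *\<^sub>R x) - t * q x) \<le> r y" if "t \<ge> 0" for t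
    proof (rule lower)
      fix s :: real assume "s \<ge> 0"
      have "r (y + z) \<le> q ((y + s *\<^sub>R x) + (z + t *\<^sub>R x)) - (s + t) * q x"
        using upper[of "s + t" "y + z"] \<open>s \<ge> 0\<close> \<open>t \<ge> 0\<close> by (simp add: algebra_simps)
      also have "\<dots> \<le> q (y + s *\<^sub>R x) + q (z + t *\<^sub>R x) - (s + t) * q x"
        using sublinear_add[OF q] by simp
      finally show "r (y + z) - (q (z + t *\<^sub>R x) - t * q x) \<le> q (y + s *\<^sub>R x) - s * q x"
        by (simp add: algebra_simps)
    qed
    then have "r (y + z) - r y \<le> r z"
      by (intro lower) (smt (verit))
    then show "r (y + z) \<le> r y + r z" by simp
  next
    show "r 0 = 0"
    proof (rule antisym)
      show "r 0 \<le> 0"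
        using upper[of 0 0] sublinear_0[OF q] by simp
      show "0 \<le> r 0"
        by (rule lower) (simp add: sublinear_scaleR[OF q])
    qed
  next
    fix t :: real and y assume "t > 0"
    have "inverse t * r (t *\<^sub>R y) \<le> r y"
    proof (rule lower)
      fix s :: real assume "s \<ge> 0"
      have "r (t *\<^sub>R y) \<le> q (t *\<^sub>R (y + s *\<^sub>R x)) - (t * s) * q x"
        using upper[of "t * s" "t *\<^sub>R y"] \<open>s \<ge> 0\<close> \<open>t > 0\<close> by (simp add: algebra_simps)
      also have "\<dots> = t * (q (y + s *\<^sub>R x) - s * q x)"
        using sublinear_scaleR[OF q, of t "y + s *\<^sub>R x"] \<open>t > 0\<close> by (simp add: right_diff_distrib)
      finally show "inverse t * r (t *\<^sub>R y) \<le> q (y + s *\<^sub>R x) - s * q x"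
        using \<open>t > 0\<close> by (simp add: field_simps)
    qed
    then show "r (t *\<^sub>R y) \<le> t * r y"
      using \<open>t > 0\<close> by (simp add: field_simps)
  qed
qed

text \<open>The pointwise infimum works: given one member nearly optimal at \<open>x\<close> and
  another at \<open>y\<close>, the smaller of the two serves both points, which yields
  subadditivity.\<close>

lemma chain_of_sublinear_bounded_below:
  fixes p :: "'a::real_vector \<Rightarrow> real"
  assumes C: "C \<noteq> {}" "\<And>q. q \<in> C \<Longrightarrow> sublinear q \<and> q \<le> p"
    and chain: "\<And>q r. q \<in> C \<Longrightarrow> r \<in> C \<Longrightarrow> q \<le> r \<or> r \<le> q"
  obtains s where "sublinear s" "\<And>q. q \<in> C \<Longrightarrow> s \<le> q"
proof
  define s where "s x = (INF q\<in>C. q x)" for x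
  \<comment> \<open>Every sublinear \<open>q \<le> p\<close> satisfies
    \<open>q x \<ge> - q (- x) \<ge> - p (- x)\<close>, a bound independent of
    \<open>q\<close>.\<close>
  have bdd: "bdd_below ((\<lambda>q. q x) ` C)" for x
  proof (rule bdd_belowI2)
    fix q assume "q \<in> C"
    then show "- p (- x) \<le> q x"
      using C(2)[of q] sublinear_minus[of q x] by (auto simp: le_fun_def) (smt (verit))
  qed
  have upper: "s x \<le> q x" if "q \<in> C" for q x
    unfolding s_def by (rule cINF_lower[OF bdd that])
  have lower: "c \<le> s x" if "\<And>q. q \<in> C \<Longrightarrow> c \<le> q x" for c x
    unfolding s_def by (rule cINF_greatest[OF C(1)]) (use that in auto)
  show "s \<le> q" if "q \<in> C" for q
    using upper[OF that] by (simp add: le_fun_def)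
  show "sublinear s"
  proof (rule sublinearI)
    fix x y
    have sum: "s (x + y) \<le> q x + r y" if qr: "q \<in> C" "r \<in> C" for q r
    proof -
      obtain m where "m \<in> C" "m \<le> q" "m \<le> r"
        using chain[OF qr] qr by blast
      then show ?thesis
        using upper[of m "x + y"] sublinear_add[of m x y] C(2)[of m]
        by (auto simp: le_fun_def) (smt (verit))
    qed
    have "s (x + y) - r y \<le> s x" if "r \<in> C" for r
      by (rule lower) (use sum that in \<open>smt (verit)\<close>)
    then have "s (x + y) - s x \<le> s y"
      by (intro lower) (smt (verit))
    then show "s (x + y) \<le> s x + s y" by simp
  next
    show "s 0 = 0"
      unfolding s_def using C by (simp add: sublinear_0 cong: INF_cong)
  next
    fix t :: real and x assume "t > 0"
    have "inverse t * s (t *\<^sub>R x) \<le> s x"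
    proof (rule lower)
      fix q assume "q \<in> C"
      then show "inverse t * s (t *\<^sub>R x) \<le> q x"
        using upper[of q "t *\<^sub>R x"] sublinear_scaleR[of q t x] C(2)[of q] \<open>t > 0\<close>
        by (simp add: field_simps)
    qed
    then show "s (t *\<^sub>R x) \<le> t * s x"
      using \<open>t > 0\<close> by (simp add: field_simps)
  qed
qed

text \<open>Minimal sublinear functionals are linear, by \<open>sublinear_decrease\<close>.\<close>

lemma sublinear_dominates_linear:
  fixes p :: "'a::real_vector \<Rightarrow> real"
  assumes p: "sublinear p"
  obtains u where "linear u" "u \<le> p"
proof -
  define Q where "Q = {q. sublinear q \<and> q \<le> p}"
  have "\<exists>u\<in>Q. \<forall>q\<in>Q. q \<le> u \<longrightarrow> q = u"
  proof (rule predicate_Zorn)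
    \<comment> \<open>The order is reversed, so that the maximal elements of Zorn's lemma are
      minimal functionals.\<close>
    show "partial_order_on Q (relation_of (\<lambda>q r. r \<le> q) Q)"
      by (auto intro!: partial_order_on_relation_ofI)
    fix C assume C: "C \<in> Chains (relation_of (\<lambda>q r. r \<le> q) Q)"
    then have CQ: "C \<subseteq> Q" and chain: "\<And>q r. q \<in> C \<Longrightarrow> r \<in> C \<Longrightarrow> q \<le> r \<or> r \<le> q"
      by (auto simp: Chains_def relation_of_def)
    show "\<exists>s\<in>Q. \<forall>q\<in>C. s \<le> q"
    proof (cases "C = {}")
      case True
      then show ?thesis using p by (auto simp: Q_def)
    next
      case False
      obtain s where "sublinear s" "\<And>q. q \<in> C \<Longrightarrow> s \<le> q"
        using chain_of_sublinear_bounded_below[of C p] False CQ chain by (auto simp: Q_def)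
      moreover from this have "s \<le> p"
        using False CQ by (auto simp: Q_def intro: order_trans)
      ultimately show ?thesis
        by (auto simp: Q_def)
    qed
  qed
  then obtain u where "u \<in> Q" and min: "\<And>q. q \<in> Q \<Longrightarrow> q \<le> u \<Longrightarrow> q = u"
    by blast
  then have u: "sublinear u" and "u \<le> p"
    by (auto simp: Q_def)
  have odd: "u (- x) = - u x" for x
  proof -
    obtain r where "sublinear r" "r \<le> u" "r (- x) \<le> - u x"
      by (rule sublinear_decrease[OF u])
    then have "u (- x) \<le> - u x"
      using min[of r] \<open>u \<le> p\<close> by (auto simp: Q_def)
    then show ?thesis
      using sublinear_minus[OF u, of x] by simp
  qed
  have "linear u"
  proof (rule linearI)
    fix x y
    show "u (x + y) = u x + u y"
      using sublinear_add[OF u, of x y] sublinear_add[OF u, of "- x" "- y"] odd[of "x + y"] odd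
      by simp
    fix t
    show "u (t *\<^sub>R x) = t *\<^sub>R u x"
      using sublinear_scaleR[OF u, of t x] sublinear_scaleR[OF u, of "- t" x] odd[of "t *\<^sub>R x"]
      by (cases "t \<ge> 0") auto
  qed
  with \<open>u \<le> p\<close> that show thesis by blast
qed

section \<open>Bounded complex-linear maps and separation of points from 0\<close>

definition bounded_clinear :: "('a::complex_banach \<Rightarrow> 'b::complex_banach) \<Rightarrow> bool" where
  "bounded_clinear f \<longleftrightarrow> bounded_linear f \<and> (\<forall>c x. f (c *\<^sub>C x) = c *\<^sub>C f x)"

lemma scaleC_scaleR_commute: "c *\<^sub>C t *\<^sub>R x = t *\<^sub>R c *\<^sub>C (x::'a::complex_banach)"
  by (simp flip: scaleC_of_real add: scaleC_scaleC mult.commute)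

lemma bounded_bilinear_scaleC:
  "bounded_bilinear (scaleC :: complex \<Rightarrow> 'a \<Rightarrow> 'a::complex_banach)"
proof
  fix a b :: complex and x y :: 'a and t :: real
  show "(t *\<^sub>R a) *\<^sub>C x = t *\<^sub>R a *\<^sub>C x"
    by (simp add: scaleR_conv_of_real scaleC_of_real flip: scaleC_scaleC)
  show "\<exists>K. \<forall>a (x::'a). norm (a *\<^sub>C x) \<le> norm a * norm x * K"
    by (rule exI[of _ 1]) (simp add: norm_scaleC)
qed (simp_all add: scaleC_add_left scaleC_add_right scaleC_scaleR_commute)

text \<open>Lowering the norm at \<open>x\<close> and taking a linear \<open>u\<close> below the
  result gives \<open>u x \<ge> norm x > 0\<close>. The real functional \<open>u\<close> is then
  complexified and normalised at \<open>x\<close>.\<close>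

lemma separating_functional:
  fixes x :: "'a::complex_banach"
  assumes "x \<noteq> 0"
  obtains f :: "'a \<Rightarrow> complex" where "bounded_clinear f" "f x = 1"
proof -
  interpret scaleC: bounded_bilinear "scaleC :: complex \<Rightarrow> 'a \<Rightarrow> 'a"
    by (rule bounded_bilinear_scaleC)
  have "sublinear (norm :: 'a \<Rightarrow> real)"
    by (simp add: sublinear_def norm_triangle_ineq)
  then obtain r where r: "sublinear r" "r \<le> norm" "r (- x) \<le> - norm x"
    by (rule sublinear_decrease)
  then obtain u where u: "linear u" "u \<le> r"
    by (auto elim: sublinear_dominates_linear)
  interpret u: linear u by fact
  have le: "u y \<le> norm y" for y
    using u(2) r(2) by (meson le_funD order_trans)
  then have abs_le: "\<bar>u y\<bar> \<le> norm y" for y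
    using le[of "- y"] le[of y] by (simp add: u.neg abs_le_iff)
  have "u (- x) \<le> - norm x"
    using u(2) r(3) by (meson le_funD order_trans)
  then have "u x > 0"
    using assms by (simp add: u.neg) (smt (verit) norm_ge_zero zero_less_norm_iff)
  \<comment> \<open>The only complex-linear functional with real part \<open>u\<close>: the
    imaginary part is forced by \<open>g (\<i> *\<^sub>C y) = \<i> * g y\<close>.\<close>
  define g where "g y = Complex (u y) (- u (\<i> *\<^sub>C y))" for y
  have g: "g (c *\<^sub>C y) = c * g y" for c y
  proof -
    have *: "c *\<^sub>C y = Re c *\<^sub>R y + Im c *\<^sub>R \<i> *\<^sub>C y" for c and y :: 'a
      by (metis complex_eq scaleC_add_left scaleC_of_real scaleC_scaleC mult.commute)
    have "u (c *\<^sub>C y) = Re c * u y + Im c * u (\<i> *\<^sub>C y)" for c y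
      unfolding *[of c y] by (simp add: u.add u.scale)
    from this[of c y] this[of "\<i> * c" y] show ?thesis
      by (simp add: g_def complex_eq_iff scaleC_scaleC)
  qed
  have "bounded_linear g"
  proof (rule bounded_linear_intro)
    show "g (y + z) = g y + g z" for y z
      by (simp add: g_def u.add scaleC.add_right complex_eq_iff)
    show "g (t *\<^sub>R y) = t *\<^sub>R g y" for t y
      using g[of "of_real t" y] by (simp add: scaleC_of_real scaleR_conv_of_real)
    show "norm (g y) \<le> norm y * 2" for y
      using cmod_le[of "g y"] abs_le[of y] abs_le[of "\<i> *\<^sub>C y"] by (simp add: g_def norm_scaleC)
  qed
  then have "bounded_clinear (\<lambda>y. g y / g x)"
    by (auto simp: bounded_clinear_def g scaleC_complex_def intro: bounded_linear_divide bounded_linear_compose)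
  moreover have "g x \<noteq> 0"
    using \<open>u x > 0\<close> by (simp add: g_def complex_eq_iff)
  ultimately show thesis
    using that[of "\<lambda>y. g y / g x"] by simp
qed

section \<open>Biorthogonal systems\<close>

interpretation C: vector_space "scaleC :: complex \<Rightarrow> 'a \<Rightarrow> 'a::complex_banach"
  by (rule vector_space_scaleC)

lemma bounded_clinear_imp_bounded_linear: "bounded_clinear f \<Longrightarrow> bounded_linear f"
  by (simp add: bounded_clinear_def)

lemma bounded_clinear_imp_linear: "bounded_clinear f \<Longrightarrow> linear f"
  by (simp add: bounded_clinear_def bounded_linear.linear)

lemma bounded_clinear_scaleC: "bounded_clinear f \<Longrightarrow> f (c *\<^sub>C x) = c *\<^sub>C f x"
  by (simp add: bounded_clinear_def)

lemmas bounded_clinear_simps =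
  linear_0[OF bounded_clinear_imp_linear] linear_add[OF bounded_clinear_imp_linear]
  linear_diff[OF bounded_clinear_imp_linear] linear_neg[OF bounded_clinear_imp_linear]
  bounded_clinear_scaleC

lemma continuous_on_bounded_clinear:
  "bounded_clinear f \<Longrightarrow> continuous_on A g \<Longrightarrow> continuous_on A (\<lambda>x. f (g x))"
  by (rule bounded_linear.continuous_on[OF bounded_clinear_imp_bounded_linear])

lemma bounded_clinear_zero: "bounded_clinear (\<lambda>_. 0)"
  by (simp add: bounded_clinear_def)

lemma bounded_clinear_add:
  "bounded_clinear f \<Longrightarrow> bounded_clinear g \<Longrightarrow> bounded_clinear (\<lambda>x. f x + g x)"
  by (simp add: bounded_clinear_def bounded_linear_add scaleC_add_right)

lemma bounded_clinear_compose:
  "bounded_clinear f \<Longrightarrow> bounded_clinear g \<Longrightarrow> bounded_clinear (\<lambda>x. f (g x))"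
  by (simp add: bounded_clinear_def bounded_linear_compose)

lemma bounded_clinear_ident_minus:
  "bounded_clinear f \<Longrightarrow> bounded_clinear (\<lambda>x. x - f x)"
  by (simp add: bounded_clinear_def bounded_linear_sub C.scale_right_diff_distrib)

lemma bounded_clinear_rank_one:
  "bounded_clinear f \<Longrightarrow> bounded_clinear (\<lambda>x. f x *\<^sub>C e)"
  by (auto simp: bounded_clinear_def scaleC_complex_def scaleC_scaleC
      intro: bounded_bilinear.bounded_linear_left[OF bounded_bilinear_scaleC, THEN bounded_linear_compose])

lemma bounded_clinear_imp_Vector_Spaces_linear:
  "bounded_clinear f \<Longrightarrow> Vector_Spaces.linear scaleC scaleC f"
  by (auto simp: Vector_Spaces.linear_iff vector_space_scaleC bounded_clinear_simps)

lemma finite_span_imp_not_infinite_dimensional: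
  fixes S :: "'a::complex_banach set"
  assumes "finite S" "C.span S = UNIV"
  shows "\<not> infinite_dimensional TYPE('a)"
proof -
  obtain B where B: "B \<subseteq> S" "C.independent B" "S \<subseteq> C.span B"
    by (rule C.maximal_independent_subset)
  then have "C.span B = UNIV"
    using C.span_mono[OF B(3)] assms(2) by (simp add: C.span_span top.extremum_uniqueI)
  with B assms(1) have "finite_dimensional_vector_space (scaleC :: complex \<Rightarrow> 'a \<Rightarrow> 'a) B"
    by unfold_locales (auto intro: finite_subset)
  then show ?thesis
    by (auto simp: infinite_dimensional_def)
qed

text \<open>
  Gram--Schmidt with functionals in place of an inner product: \<open>projection n\<close> projects onto
  the span of the first \<open>n\<close> vectors, and the next vector is the residual of the first term of the
  dense sequence \<open>d\<close> that is not yet fixed.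
\<close>

context
  fixes d :: "nat \<Rightarrow> 'a::complex_banach" and g :: "'a \<Rightarrow> 'a \<Rightarrow> complex"
  assumes g: "x \<noteq> 0 \<Longrightarrow> bounded_clinear (g x)" "x \<noteq> 0 \<Longrightarrow> g x x = 1"
    and dense: "closure (range d) = UNIV"
    and inf: "infinite_dimensional TYPE('a)"
begin

text \<open>Unspecified when \<open>P\<close> fixes every \<open>d k\<close>;
  \<open>exists_moved\<close> excludes this for the projections.\<close>

definition first_moved :: "('a \<Rightarrow> 'a) \<Rightarrow> nat" where
  "first_moved P = (LEAST k. P (d k) \<noteq> d k)"

definition residual :: "('a \<Rightarrow> 'a) \<Rightarrow> 'a" where
  "residual P = d (first_moved P) - P (d (first_moved P))"

primrec projection :: "nat \<Rightarrow> 'a \<Rightarrow> 'a" where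
  "projection 0 = (\<lambda>_. 0)"
| "projection (Suc n) = (\<lambda>x. projection n x +
     g (residual (projection n)) (x - projection n x) *\<^sub>C residual (projection n))"

definition basis_vector :: "nat \<Rightarrow> 'a" where
  "basis_vector n = residual (projection n)"

definition coordinate :: "nat \<Rightarrow> 'a \<Rightarrow> complex" where
  "coordinate n x = g (basis_vector n) (x - projection n x)"

lemma projection_Suc: "projection (Suc n) x = projection n x + coordinate n x *\<^sub>C basis_vector n"
  by (simp add: coordinate_def basis_vector_def)

declare projection.simps(2) [simp del]

lemma projection_in_span: "projection n x \<in> C.span (basis_vector ` {..<n})"
proof (induction n)
  case (Suc n)
  have "basis_vector ` {..<n} \<subseteq> basis_vector ` {..<Suc n}" by auto
  with Suc have "projection n x \<in> C.span (basis_vector ` {..<Suc n})"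
    using C.span_mono by blast
  then show ?case
    unfolding projection_Suc by (intro C.span_add C.span_scale[OF C.span_base]) auto
qed (simp add: C.span_zero)

text \<open>A continuous map fixing a dense set is the identity, and then finitely many vectors
  would span the space. This is where infinite dimension enters.\<close>

lemma exists_moved:
  assumes "bounded_clinear (projection n)"
  shows "\<exists>k. projection n (d k) \<noteq> d k"
proof (rule ccontr)
  assume "\<not> ?thesis"
  then have "range d \<subseteq> {x. projection n x = x}" by auto
  moreover have "closed {x. projection n x = x}"
    by (intro closed_Collect_eq continuous_on_bounded_clinear[OF assms] continuous_intros)
  ultimately have "projection n x = x" for x
    using dense closure_minimal by blast
  then have "C.span (basis_vector ` {..<n}) = UNIV"
    using projection_in_span[of n] by (metis UNIV_eq_I)
  then show False
    using finite_span_imp_not_infinite_dimensional[of "basis_vector ` {..<n}"] inf by simp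
qed

text \<open>The two claims depend on each other: boundedness of \<open>projection n\<close> makes
  the next residual nonzero, and \<open>g\<close> is known to be bounded only at nonzero
  vectors.\<close>

lemma bounded_clinear_projection: "bounded_clinear (projection n)"
  and basis_vector_nonzero: "basis_vector n \<noteq> 0"
proof -
  have nonzero: "basis_vector n \<noteq> 0" if "bounded_clinear (projection n)" for n
    using LeastI_ex[OF exists_moved[OF that]]
    by (simp add: basis_vector_def residual_def first_moved_def)
  show *: "bounded_clinear (projection n)" for n
  proof (induction n)
    case (Suc n)
    show ?case
      unfolding projection_Suc[abs_def] coordinate_def
      by (intro bounded_clinear_add bounded_clinear_rank_one Suc
          bounded_clinear_compose[OF g(1)[OF nonzero[OF Suc]]] bounded_clinear_ident_minus)
  qed (simp add: bounded_clinear_zero)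
  show "basis_vector n \<noteq> 0"
    by (rule nonzero[OF *])
qed

lemmas projection_simps = bounded_clinear_simps[OF bounded_clinear_projection]

lemma bounded_clinear_coordinate: "bounded_clinear (coordinate n)"
  unfolding coordinate_def[abs_def]
  by (intro bounded_clinear_compose[OF g(1)[OF basis_vector_nonzero]] bounded_clinear_ident_minus
      bounded_clinear_projection)

text \<open>\<open>basis_vector n\<close> has the form \<open>x - projection n x\<close>, so the
  earlier projections annihilate it. For \<open>m = Suc n\<close> it remains that
  \<open>coordinate n\<close> is 1 at \<open>basis_vector n\<close> and 0 on the range of
  \<open>projection n\<close>.\<close>

lemma projection_projection_le: "m \<le> n \<Longrightarrow> projection m (projection n x) = projection m x"
proof (induction n arbitrary: m x)
  case (Suc n)
  have vanish: "projection m (basis_vector n) = 0" if "m \<le> n" for m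
    using Suc.IH[OF that] by (simp add: basis_vector_def residual_def projection_simps)
  show ?case
  proof (cases "m \<le> n")
    case True
    then show ?thesis
      by (simp add: projection_Suc projection_simps Suc.IH vanish)
  next
    case False
    with Suc.prems have m: "m = Suc n" by simp
    have "coordinate n (basis_vector n) = 1" "coordinate n (projection n x) = 0"
      using g[OF basis_vector_nonzero[of n]] Suc.IH[of n] vanish[of n]
      by (simp_all add: coordinate_def bounded_clinear_simps)
    then show ?thesis
      unfolding m using Suc.IH[of n x] vanish[of n]
      by (simp add: projection_Suc bounded_clinear_simps[OF bounded_clinear_coordinate] projection_simps)
  qed
qed (simp add: projection_simps)

lemma projection_basis_vector:
  "projection m (basis_vector n) = (if n < m then basis_vector n else 0)"
proof -
  have zero: "projection m (basis_vector n) = 0" if "m \<le> n" for m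
    using projection_projection_le[OF that]
    by (simp add: basis_vector_def residual_def projection_simps)
  have "projection m (basis_vector n) = basis_vector n" if "n < m"
    using that
  proof (induction m)
    case (Suc m)
    show ?case
    proof (cases "n = m")
      case True
      then show ?thesis
        using g(2)[OF basis_vector_nonzero[of n]] zero[of n]
        by (simp add: projection_Suc coordinate_def)
    next
      case False
      with Suc have "projection m (basis_vector n) = basis_vector n" by simp
      then show ?thesis
        using bounded_clinear_simps(1)[OF g(1)[OF basis_vector_nonzero[of m]]]
        by (simp add: projection_Suc coordinate_def)
    qed
  qed simp
  with zero show ?thesis by simp
qed

lemma coordinate_basis_vector: "coordinate m (basis_vector n) = (if m = n then 1 else 0)"
proof -
  \<comment> \<open>The rank-one increment between successive projections isolates one coordinate;
    the nonzero basis vector is cancelled at the end.\<close>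
  have "coordinate m (basis_vector n) *\<^sub>C basis_vector m =
      projection (Suc m) (basis_vector n) - projection m (basis_vector n)"
    by (simp add: projection_Suc)
  also have "\<dots> = (if m = n then 1 else 0) *\<^sub>C basis_vector m"
    by (auto simp: projection_basis_vector less_Suc_eq)
  finally show ?thesis
    using basis_vector_nonzero by (metis C.scale_right_imp_eq)
qed

text \<open>Stage \<open>n\<close> repairs \<open>d n\<close> if it is still moved: all earlier
  terms are fixed, so \<open>d n\<close> is the term chosen, and adding its own residual with
  coefficient 1 completes it. Terms already fixed have coordinate 0 and stay fixed.\<close>

lemma projection_fixes: "j < n \<Longrightarrow> projection n (d j) = d j"
proof (induction n arbitrary: j)
  case (Suc n)
  show ?case
  proof (cases "projection n (d j) = d j")
    case True
    then show ?thesis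
      using bounded_clinear_simps(1)[OF g(1)[OF basis_vector_nonzero[of n]]]
      by (simp add: projection_Suc coordinate_def)
  next
    case False
    with Suc have "j = n"
      by (auto simp: less_Suc_eq)
    with False Suc.IH have "first_moved (projection n) = j"
      unfolding first_moved_def by (intro Least_equality) (blast, meson not_le)
    then have "basis_vector n = d j - projection n (d j)"
      by (simp add: basis_vector_def residual_def)
    then show ?thesis
      using g(2)[OF basis_vector_nonzero[of n]] by (simp add: projection_Suc coordinate_def)
  qed
qed simp

lemma closure_span_basis_vector: "closure (C.span (range basis_vector)) = UNIV"
proof -
  have "d j \<in> C.span (range basis_vector)" for j
    using projection_fixes[of j "Suc j"] projection_in_span[of "Suc j" "d j"]
      C.span_mono[of "basis_vector ` {..<Suc j}" "range basis_vector"] by auto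
  then show ?thesis
    using closure_mono[of "range d" "C.span (range basis_vector)"] dense by auto
qed

end

lemma fundamental_biorthogonal_system:
  assumes "infinite_dimensional TYPE('a::complex_banach)"
    and "separable_space (euclidean :: 'a::complex_banach topology)"
  obtains e :: "nat \<Rightarrow> 'a::complex_banach" and f :: "nat \<Rightarrow> 'a \<Rightarrow> complex"
  where "\<And>n. bounded_clinear (f n)" "\<And>m n. f m (e n) = (if m = n then 1 else 0)"
    "closure (C.span (range e)) = UNIV"
proof -
  obtain D :: "'a set" where D: "countable D" "closure D = UNIV"
    using assms(2) by (auto simp: separable_space_def)
  define d where "d = from_nat_into D"
  have d: "closure (range d) = UNIV"
    using D by (metis d_def UNIV_not_empty closure_empty range_from_nat_into)
  have "\<exists>h :: 'a \<Rightarrow> complex. x \<noteq> 0 \<longrightarrow> bounded_clinear h \<and> h x = 1" for x :: 'a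
    by (metis separating_functional)
  then obtain g :: "'a \<Rightarrow> 'a \<Rightarrow> complex"
    where g: "\<And>x. x \<noteq> 0 \<Longrightarrow> bounded_clinear (g x)" "\<And>x. x \<noteq> 0 \<Longrightarrow> g x x = 1"
    by metis
  note facts = g d assms(1)
  show thesis
    by (rule that[OF bounded_clinear_coordinate[OF facts] coordinate_basis_vector[OF facts]
          closure_span_basis_vector[OF facts]])
qed

section \<open>Series of rank-one operators and universal vectors\<close>

lemma bounded_clinear_funpow:
  fixes f :: "'a::complex_banach \<Rightarrow> 'a"
  shows "bounded_clinear f \<Longrightarrow> bounded_clinear (f ^^ n)"
proof (induction n)
  case 0
  then show ?case by (simp add: bounded_clinear_def id_def)
next
  case (Suc n)
  then show ?case by (simp add: bounded_clinear_compose o_def)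
qed

text \<open>The norms of \<open>e n\<close> and \<open>f n\<close> may grow arbitrarily, so the
  weights absorb both and leave a geometric majorant.\<close>

lemma summable_rank_one_series:
  fixes e :: "nat \<Rightarrow> 'a::complex_banach" and f :: "nat \<Rightarrow> 'b::complex_banach \<Rightarrow> complex"
  assumes f: "\<And>n. bounded_clinear (f n)"
  obtains w :: "nat \<Rightarrow> complex" and S :: "'b \<Rightarrow> 'a"
  where "\<And>n. w n \<noteq> 0" "bounded_clinear S" "\<And>x. (\<lambda>n. (w n * f n x) *\<^sub>C e n) sums S x"
proof -
  have "\<exists>K>0. \<forall>x. cmod (f n x) \<le> norm x * K" for n
    using bounded_linear.pos_bounded[OF bounded_clinear_imp_bounded_linear[OF f]] .
  then obtain K where K: "\<And>n. K n > 0" "\<And>n x. cmod (f n x) \<le> norm x * K n"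
    by metis
  \<comment> \<open>Adding 1 keeps the denominator positive even if \<open>e n = 0\<close>.\<close>
  define w where "w n = complex_of_real ((1/2) ^ n / (K n * (1 + norm (e n))))" for n
  define S where "S x = (\<Sum>n. (w n * f n x) *\<^sub>C e n)" for x
  have pos: "1 + norm (e n) > 0" for n
    by (simp add: add_pos_nonneg)
  have norm_le: "norm ((w n * f n x) *\<^sub>C e n) \<le> (1/2) ^ n * norm x" for n x
  proof -
    have "norm ((w n * f n x) *\<^sub>C e n)
        = (1/2) ^ n * (cmod (f n x) / K n) * (norm (e n) / (1 + norm (e n)))"
      using K(1)[of n] pos[of n]
      by (simp add: w_def norm_scaleC norm_mult norm_divide norm_power field_simps flip: of_real_add)
    also have "\<dots> \<le> (1/2) ^ n * norm x * 1"
      using K[of n] pos[of n] by (intro mult_mono) (auto simp: field_simps)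
    finally show ?thesis by simp
  qed
  have geometric: "summable (\<lambda>n. (1/2) ^ n * norm x)" for x :: 'b
    by (intro summable_mult2 summable_geometric) simp
  then have summable: "summable (\<lambda>n. (w n * f n x) *\<^sub>C e n)" for x
    by (rule summable_comparison_test'[where N = 0]) (rule norm_le)
  have scale: "S (c *\<^sub>C x) = c *\<^sub>C S x" for c x
    using bounded_linear.suminf[OF bounded_bilinear.bounded_linear_right[OF bounded_bilinear_scaleC]
        summable, of c x]
    by (simp add: S_def bounded_clinear_simps[OF f] scaleC_complex_def scaleC_scaleC ac_simps)
  have "bounded_linear S"
  proof (rule bounded_linear_intro)
    show "S (x + y) = S x + S y" for x y
      using suminf_add[OF summable[of x] summable[of y]]
      by (simp add: S_def bounded_clinear_simps[OF f] distrib_left scaleC_add_left)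
    show "S (t *\<^sub>R x) = t *\<^sub>R S x" for t x
      using scale[of "of_real t" x] by (simp add: scaleC_of_real)
    show "norm (S x) \<le> norm x * 2" for x
    proof -
      have "norm (S x) \<le> (\<Sum>n. (1/2) ^ n * norm x)"
        unfolding S_def by (rule norm_suminf_le[OF norm_le geometric])
      also have "\<dots> = norm x * 2"
        using suminf_mult2[of "\<lambda>n. (1/2) ^ n" "norm x"] suminf_geometric[of "1/2 :: real"]
        by (simp add: summable_geometric)
      finally show ?thesis .
    qed
  qed
  moreover have "w n \<noteq> 0" for n
    using K(1)[of n] pos[of n] by (simp add: w_def flip: of_real_add)
  moreover have "(\<lambda>n. (w n * f n x) *\<^sub>C e n) sums S x" for x
    unfolding S_def by (rule summable_sums[OF summable])
  ultimately show thesis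
    using that[of w S] scale by (simp add: bounded_clinear_def)
qed

text \<open>Birkhoff's transitivity argument.\<close>

lemma universal_vector_exists:
  fixes L :: "'i \<Rightarrow> 'a::complete_space \<Rightarrow> 'b::metric_space"
  assumes cont: "\<And>i. continuous_on UNIV (L i)"
    and D: "countable D" "closure D = (UNIV :: 'b set)"
    and W: "closure W = (UNIV :: 'a set)" and V: "closure V = (UNIV :: 'b set)"
    and trans: "\<And>y z \<epsilon>. y \<in> W \<Longrightarrow> z \<in> V \<Longrightarrow> \<epsilon> > 0 \<Longrightarrow> \<exists>i y'. dist y' y < \<epsilon> \<and> dist (L i y') z < \<epsilon>"
  shows "\<exists>y. closure (range (\<lambda>i. L i y)) = UNIV"
proof -
  \<comment> \<open>A point lying in \<open>U z m\<close> for all \<open>z \<in> D\<close> and all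
    \<open>m\<close> has images approaching every point of \<open>D\<close>. Baire supplies such a
    point, since these countably many sets are open and dense.\<close>
  define U where "U z m = (\<Union>i. {y. dist (L i y) z < 1 / Suc m})" for z m
  have "open (U z m)" for z m
    unfolding U_def by (intro open_UN ballI open_Collect_less continuous_intros cont)
  moreover have "closure (U z m) = UNIV" for z m
  proof -
    have "\<exists>y'\<in>U z m. dist y' y < \<epsilon>" if "\<epsilon> > 0" for y \<epsilon>
    proof -
      \<comment> \<open>Two errors of size \<open>\<delta>\<close> add up in each space: one from
        moving to \<open>W\<close> or \<open>V\<close>, one from transitivity.\<close>
      define \<delta> where "\<delta> = min \<epsilon> (1 / Suc m) / 2"
      have "\<delta> > 0"
        using that by (simp add: \<delta>_def)
      obtain y1 where y1: "y1 \<in> W" "dist y1 y < \<delta>"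
        using W \<open>\<delta> > 0\<close> by (metis UNIV_I closure_approachable)
      obtain z1 where z1: "z1 \<in> V" "dist z1 z < \<delta>"
        using V \<open>\<delta> > 0\<close> by (metis UNIV_I closure_approachable)
      obtain i y' where y': "dist y' y1 < \<delta>" "dist (L i y') z1 < \<delta>"
        using trans[OF y1(1) z1(1) \<open>\<delta> > 0\<close>] by blast
      have "\<delta> + \<delta> \<le> \<epsilon>" "\<delta> + \<delta> \<le> 1 / Suc m"
        by (simp_all only: \<delta>_def field_sum_of_halves min.cobounded1 min.cobounded2)
      moreover have "dist y' y < \<delta> + \<delta>" "dist (L i y') z < \<delta> + \<delta>"
        using y1 y' z1 dist_triangle[of y' y y1] dist_triangle[of "L i y'" z z1] by linarith+
      ultimately have "dist y' y < \<epsilon>" "y' \<in> U z m"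
        unfolding U_def by (auto intro!: exI[of _ i] intro: less_le_trans)
      then show ?thesis by blast
    qed
    then show ?thesis
      by (auto simp: closure_approachable)
  qed
  ultimately have "\<And>T. T \<in> (\<lambda>(z, m). U z m) ` (D \<times> UNIV) \<Longrightarrow> open T \<and> closure T = UNIV"
    by auto
  moreover have "countable ((\<lambda>(z, m). U z m) ` (D \<times> UNIV))"
    using D(1) by simp
  ultimately have "closure (\<Inter> ((\<lambda>(z, m). U z m) ` (D \<times> UNIV))) = UNIV"
    using Met_TC.metric_Baire_category[where 'a = 'a, of "(\<lambda>(z, m). U z m) ` (D \<times> UNIV)"]
    by (simp add: complete_UNIV)
  then obtain y where "y \<in> \<Inter> ((\<lambda>(z, m). U z m) ` (D \<times> UNIV))"
    by (metis UNIV_not_empty closure_empty ex_in_conv)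
  then have y: "y \<in> U z m" if "z \<in> D" for z m
    using that by auto
  have "D \<subseteq> closure (range (\<lambda>i. L i y))"
  proof
    fix z assume "z \<in> D"
    show "z \<in> closure (range (\<lambda>i. L i y))"
      unfolding closure_approachable
    proof (intro allI impI)
      fix \<epsilon> :: real assume "\<epsilon> > 0"
      then obtain m where "1 / Suc m < \<epsilon>"
        using nat_approx_posE by blast
      with y[OF \<open>z \<in> D\<close>, of m] show "\<exists>x\<in>range (\<lambda>i. L i y). dist x z < \<epsilon>"
        by (auto simp: U_def intro: less_trans)
    qed
  qed
  then show ?thesis
    using D(2) by (metis closed_closure closure_minimal top.extremum_uniqueI)
qed

section \<open>The union of the iterates\<close>

lemma bilinear_iterate_mono: "m \<le> n \<Longrightarrow> bilinear_iterate A m x y \<subseteq> bilinear_iterate A n x y"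
  by (rule lift_Suc_mono_le) auto

text \<open>Both factors lie in the iterate of the larger level. Membership in the union can thus be
  shown by multiplying members, without tracking levels.\<close>

lemma bilinear_iterates_closed:
  assumes "z \<in> (\<Union>n. bilinear_iterate A n x y)" "w \<in> (\<Union>n. bilinear_iterate A n x y)"
  shows "A z w \<in> (\<Union>n. bilinear_iterate A n x y)"
proof -
  obtain m n where "z \<in> bilinear_iterate A m x y" "w \<in> bilinear_iterate A n x y"
    using assms by blast
  then have "z \<in> bilinear_iterate A (max m n) x y" "w \<in> bilinear_iterate A (max m n) x y"
    using bilinear_iterate_mono[of _ "max m n" A x y] by (meson max.cobounded1 max.cobounded2 subsetD)+
  then have "A z w \<in> bilinear_iterate A (Suc (max m n)) x y"
    by auto
  then show ?thesis by blast
qed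

section \<open>The bilinear mapping\<close>

text \<open>The series pairs \<open>f (n + 2)\<close> with \<open>e (n + 1)\<close>. Skipping
  \<open>f 0\<close> and \<open>f 1\<close> makes \<open>S\<close> kill \<open>e 0\<close> and
  \<open>e 1\<close>; leaving out \<open>e 0\<close> keeps the range of \<open>S\<close> in the
  kernel of \<open>f 0\<close>.\<close>

lemma shift_pair_exists:
  fixes e :: "nat \<Rightarrow> 'a::complex_banach" and f :: "nat \<Rightarrow> 'a \<Rightarrow> complex"
  assumes f: "\<And>n. bounded_clinear (f n)" and fe: "\<And>m n. f m (e n) = (if m = n then 1 else 0)"
  obtains w S where "\<And>n. w n \<noteq> 0" "bounded_clinear S" "S (e 0) = 0" "S (e 1) = 0"
    "\<And>n. S (e (n + 2)) = w n *\<^sub>C e (n + 1)" "\<And>x. f 0 (S x) = 0"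
proof -
  obtain w S where w: "\<And>n. w n \<noteq> 0" and S: "bounded_clinear S"
    and sums: "\<And>x. (\<lambda>n. (w n * f (n + 2) x) *\<^sub>C e (n + 1)) sums S x"
    using summable_rank_one_series[of "\<lambda>n. f (n + 2)" "\<lambda>n. e (n + 1)"] f by blast
  have zero: "S (e m) = 0" if "m < 2" for m
    using sums[of "e m"] that by (simp add: fe sums_iff)
  have shift: "S (e (n + 2)) = w n *\<^sub>C e (n + 1)" for n
  proof -
    have "(\<lambda>m. (w m * f (m + 2) (e (n + 2))) *\<^sub>C e (m + 1)) =
        (\<lambda>m. if m = n then w m *\<^sub>C e (m + 1) else 0)"
      by (auto simp: fe)
    then show ?thesis
      using sums[of "e (n + 2)"] sums_single[of n "\<lambda>m. w m *\<^sub>C e (m + 1)"]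
      by (simp add: sums_unique2)
  qed
  have f_S: "f 0 (S x) = 0" for x
    using bounded_linear.sums[OF bounded_clinear_imp_bounded_linear[OF f] sums, of 0 x]
    by (simp add: bounded_clinear_simps[OF f] fe scaleC_complex_def sums_iff)
  show thesis
    by (rule that[OF w S zero zero shift f_S]) simp_all
qed

section \<open>Shifts along the biorthogonal system and a universal vector\<close>

context
  fixes e :: "nat \<Rightarrow> 'a::complex_banach" and f :: "nat \<Rightarrow> 'a \<Rightarrow> complex"
    and w :: "nat \<Rightarrow> complex" and S :: "'a \<Rightarrow> 'a"
  assumes f: "\<And>n. bounded_clinear (f n)" and fe: "\<And>m n. f m (e n) = (if m = n then 1 else 0)"
    and w: "\<And>n. w n \<noteq> 0" and S: "bounded_clinear S"
    and S0: "S (e 0) = 0" and S1: "S (e 1) = 0"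
    and SS: "\<And>n. S (e (n + 2)) = w n *\<^sub>C e (n + 1)" and fS: "\<And>x. f 0 (S x) = 0"
begin

text \<open>
  Unlike \<open>S\<close>, this shift does not kill \<open>e 1\<close>, so that its range can contain \<open>e 0\<close>.
\<close>

definition full_shift :: "'a \<Rightarrow> 'a" where
  "full_shift x = f 1 x *\<^sub>C e 0 + S x"

lemma bounded_clinear_full_shift: "bounded_clinear full_shift"
  unfolding full_shift_def[abs_def] by (intro bounded_clinear_add bounded_clinear_rank_one f S)

lemmas S_simps = bounded_clinear_simps[OF S]
lemmas full_shift_simps = bounded_clinear_simps[OF bounded_clinear_full_shift]
lemmas S_power_simps = bounded_clinear_simps[OF bounded_clinear_funpow[OF S]]

text \<open>Each application lowers the index by one until \<open>e 1\<close>, which is killed. The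
  exponent is a successor because \<open>S ^^ 0\<close> does not kill \<open>e 0\<close>.\<close>

lemma S_power_zero: "m \<le> Suc n \<Longrightarrow> (S ^^ Suc n) (e m) = 0"
proof (induction n arbitrary: m)
  case 0
  then show ?case using S0 S1 by (auto simp: le_Suc_eq)
next
  case (Suc n)
  consider "m = 0" | "m = 1" | k where "m = k + 2" "k + 1 \<le> Suc n"
    using Suc.prems by (metis One_nat_def Suc_le_mono add_2_eq_Suc' add.commute not0_implies_Suc plus_1_eq_Suc)
  then show ?case
  proof cases
    case (3 k)
    have "(S ^^ Suc (Suc n)) (e m) = (S ^^ Suc n) (S (e m))"
      by (simp only: funpow_Suc_right o_apply)
    then show ?thesis
      using Suc.IH[OF 3(2)] by (simp only: 3(1) SS S_power_simps C.scale_zero_right)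
  qed (simp_all only: funpow_Suc_right o_apply S0 S1 S_simps S_power_simps)
qed

text \<open>First half of transitivity: on a dense subspace the powers of \<open>S\<close> end in
  0.\<close>

lemma S_power_eventually_zero:
  assumes "y \<in> C.span (range e)"
  shows "\<exists>N. \<forall>n\<ge>N. (S ^^ n) y = 0"
proof -
  have "C.subspace {y. \<exists>N. \<forall>n\<ge>N. (S ^^ n) y = 0}"
  proof (rule C.subspaceI)
    fix x y
    assume "x \<in> {y. \<exists>N. \<forall>n\<ge>N. (S ^^ n) y = 0}" "y \<in> {y. \<exists>N. \<forall>n\<ge>N. (S ^^ n) y = 0}"
    then obtain N M where "\<forall>n\<ge>N. (S ^^ n) x = 0" "\<forall>n\<ge>M. (S ^^ n) y = 0"
      by blast
    then have "\<forall>n\<ge>max N M. (S ^^ n) (x + y) = 0"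
      by (simp add: S_power_simps)
    then show "x + y \<in> {y. \<exists>N. \<forall>n\<ge>N. (S ^^ n) y = 0}"
      by blast
  qed (auto simp: S_power_simps)
  moreover have "\<exists>N. \<forall>n\<ge>N. (S ^^ n) (e m) = 0" for m
    using S_power_zero by (intro exI[of _ "Suc m"]) (metis Suc_leD Suc_le_D)
  ultimately show ?thesis
    using C.span_minimal[of "range e" "{y. \<exists>N. \<forall>n\<ge>N. (S ^^ n) y = 0}"] assms by blast
qed

text \<open>The indices on the way stay above 1 until the last application, so only nonzero weights
  are collected.\<close>

lemma S_power_shift: "\<exists>c. c \<noteq> 0 \<and> (S ^^ n) (e (n + 1 + i)) = c *\<^sub>C e (i + 1)"
proof (induction n)
  case 0
  show ?case by (intro exI[of _ 1]) (simp add: scaleC_one)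
next
  case (Suc n)
  then obtain c where "c \<noteq> 0" "(S ^^ n) (e (n + 1 + i)) = c *\<^sub>C e (i + 1)" by blast
  moreover have "(S ^^ Suc n) (e (Suc n + 1 + i)) = (S ^^ n) (S (e ((n + i) + 2)))"
    by (simp only: funpow_Suc_right o_apply) (simp add: ac_simps)
  ultimately show ?case
    using w by (intro exI[of _ "w (n + i) * c"]) (simp only: SS S_power_simps, simp add: scaleC_scaleC ac_simps)
qed

text \<open>For \<open>i = 0\<close> the rank-one term does the work, otherwise \<open>S\<close>
  does.\<close>

lemma full_shift_e: "\<exists>c. c \<noteq> 0 \<and> full_shift (e (i + 1)) = c *\<^sub>C e i"
proof (cases i)
  case 0
  then show ?thesis
    using S1 by (intro exI[of _ 1]) (simp add: full_shift_def fe)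
next
  case (Suc k)
  then show ?thesis
    using SS[of k] w by (intro exI[of _ "w k"]) (simp add: full_shift_def fe)
qed

text \<open>Second half of transitivity: preimages exist for a dense set of targets. Their norms may
  grow with \<open>n\<close>.\<close>

lemma full_shift_S_power_surj_span:
  assumes "z \<in> C.span (range e)"
  shows "\<exists>v. full_shift ((S ^^ n) v) = z"
proof -
  have "bounded_clinear (\<lambda>v. full_shift ((S ^^ n) v))"
    by (intro bounded_clinear_compose[OF bounded_clinear_full_shift] bounded_clinear_funpow S)
  note simps = bounded_clinear_simps[OF this]
  have "C.subspace (range (\<lambda>v. full_shift ((S ^^ n) v)))"
    by (rule C.subspaceI) (auto simp: image_iff intro: simps[symmetric] exI[of "\<lambda>v. full_shift ((S ^^ n) v) = 0", OF simps(1)])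
  moreover have "e i \<in> range (\<lambda>v. full_shift ((S ^^ n) v))" for i
  proof -
    obtain a b where "a \<noteq> 0" "(S ^^ n) (e (n + 1 + i)) = a *\<^sub>C e (i + 1)"
      "b \<noteq> 0" "full_shift (e (i + 1)) = b *\<^sub>C e i"
      using S_power_shift full_shift_e by meson
    then have "full_shift ((S ^^ n) (inverse (b * a) *\<^sub>C e (n + 1 + i))) = e i"
      by (simp add: simps full_shift_simps S_power_simps scaleC_scaleC scaleC_one field_simps)
    then show ?thesis by (metis rangeI)
  qed
  ultimately show ?thesis
    using C.span_minimal[of "range e" "range (\<lambda>v. full_shift ((S ^^ n) v))"] assms by blast
qed

text \<open>Given \<open>y\<close> and \<open>z\<close>, fix \<open>n\<close> with
  \<open>(S ^^ Suc n) y = 0\<close> and a preimage \<open>v\<close> of \<open>z\<close>. Adding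
  \<open>v / 2 ^ (n + j + 1)\<close> to \<open>y\<close> makes the image exactly \<open>z\<close>,
  and letting \<open>j\<close> grow with \<open>n\<close> fixed makes the perturbation small however
  large \<open>v\<close> is.\<close>

lemma full_shift_S_power_universal:
  assumes W: "closure (C.span (range e)) = UNIV"
    and D: "countable D" "closure D = (UNIV :: 'a set)"
  obtains y where "closure (range (\<lambda>(n, j). 2 ^ (n + j + 1) *\<^sub>C full_shift ((S ^^ Suc n) y))) = UNIV"
proof -
  define L where "L = (\<lambda>(n, j :: nat) y. (2 :: complex) ^ (n + j + 1) *\<^sub>C full_shift ((S ^^ Suc n) y))"
  have "bounded_clinear (\<lambda>y. full_shift ((S ^^ n) y))" for n
    by (intro bounded_clinear_compose[OF bounded_clinear_full_shift] bounded_clinear_funpow S)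
  then have "continuous_on UNIV (L i)" for i
    by (cases i) (auto simp: L_def simp del: funpow.simps
        intro!: bounded_bilinear.continuous_on[OF bounded_bilinear_scaleC]
          continuous_on_bounded_clinear[where f = "\<lambda>y. full_shift ((S ^^ _) y)"] continuous_intros)
  moreover have "\<exists>i y'. dist y' y < \<epsilon> \<and> dist (L i y') z < \<epsilon>"
    if yz: "y \<in> C.span (range e)" "z \<in> C.span (range e)" and "\<epsilon> > 0" for y z \<epsilon>
  proof -
    obtain n where n: "(S ^^ Suc n) y = 0"
      using S_power_eventually_zero[OF yz(1)] by (metis le_Suc_eq order_refl)
    obtain v where v: "full_shift ((S ^^ Suc n) v) = z"
      using full_shift_S_power_surj_span[OF yz(2)] by blast
    have "(\<lambda>j. norm v * (1/2) ^ (n + 1) * (1/2) ^ j) \<longlonglongrightarrow> 0"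
      by (intro tendsto_mult_right_zero LIMSEQ_power_zero) simp
    then obtain j where j: "norm v * (1/2) ^ (n + 1) * (1/2) ^ j < \<epsilon>"
      using \<open>\<epsilon> > 0\<close> by (metis (no_types, lifting) eventually_at_top_linorder order_refl order_tendstoD(2))
    define t :: complex where "t = 2 ^ (n + j + 1)"
    have t: "t \<noteq> 0" "cmod (inverse t) = (1/2) ^ (n + 1) * (1/2) ^ j"
      by (simp_all add: t_def norm_inverse norm_power norm_mult power_add power_one_over inverse_eq_divide norm_divide)
    have "L (n, j) (y + inverse t *\<^sub>C v) = z"
      unfolding L_def prod.case t_def[symmetric]
      using t(1) by (simp only: S_power_simps full_shift_simps n v scaleC_scaleC) (simp add: scaleC_one)
    moreover have "dist (y + inverse t *\<^sub>C v) y < \<epsilon>"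
      using j by (simp add: dist_norm norm_scaleC t(2) mult_ac)
    ultimately show ?thesis
      using \<open>\<epsilon> > 0\<close> by (metis dist_self)
  qed
  ultimately obtain y where "closure (range (\<lambda>i. L i y)) = UNIV"
    using universal_vector_exists[of L D "C.span (range e)" "C.span (range e)"] D W by blast
  then show thesis
    using that[of y] by (simp add: L_def case_prod_unfold)
qed

text \<open>The summand with \<open>f 1\<close> vanishes when a factor is a multiple of
  \<open>e 0\<close>, but completes \<open>S\<close> to \<open>full_shift\<close> when one factor is
  \<open>e 0 + e 1\<close> and the other lies in the kernel of \<open>f 0\<close>.\<close>

definition shift_product :: "'a \<Rightarrow> 'a \<Rightarrow> 'a" where
  "shift_product x z = (f 0 x * f 0 z + f 1 x * f 1 z) *\<^sub>C e 0 + (f 0 x *\<^sub>C S z + f 0 z *\<^sub>C S x)"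

lemma shift_product_commute: "shift_product x z = shift_product z x"
  by (simp add: shift_product_def ac_simps)

lemma complex_bilinear_shift_product: "complex_bilinear shift_product"
proof -
  have "Vector_Spaces.linear scaleC scaleC (shift_product x)" for x
    by (auto simp: shift_product_def Vector_Spaces.linear_iff vector_space_scaleC bounded_clinear_simps[OF f]
        S_simps scaleC_complex_def scaleC_add_left scaleC_add_right scaleC_scaleC algebra_simps)
  moreover have "(\<lambda>x. shift_product x y) = shift_product y" for y
    by (rule ext) (rule shift_product_commute)
  ultimately show ?thesis
    by (simp add: complex_bilinear_def)
qed

lemma continuous_on_shift_product: "continuous_on UNIV (\<lambda>(x, z). shift_product x z)"
  unfolding shift_product_def case_prod_unfold
  by (intro continuous_intros bounded_bilinear.continuous_on[OF bounded_bilinear_scaleC]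
      continuous_on_bounded_clinear[OF f] continuous_on_bounded_clinear[OF S])

lemma shift_product_e0_scaled: "f 0 u = 0 \<Longrightarrow> shift_product (c *\<^sub>C e 0) u = c *\<^sub>C S u"
  by (simp add: shift_product_def bounded_clinear_simps[OF f] fe scaleC_complex_def)

lemma shift_product_e0_e0: "shift_product (a *\<^sub>C e 0) (b *\<^sub>C e 0) = (a * b) *\<^sub>C e 0"
  by (simp add: shift_product_def bounded_clinear_simps[OF f] fe scaleC_complex_def S_simps S0)

lemma shift_product_e0_add_e1: "f 0 u = 0 \<Longrightarrow> shift_product (e 0 + e 1) u = full_shift u"
  by (simp add: shift_product_def full_shift_def bounded_clinear_simps[OF f] fe)

text \<open>The coordinates \<open>f 0\<close> and \<open>f 1\<close> contribute 1 each; this 2 is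
  the source of all powers of 2 in the orbit.\<close>

lemma shift_product_e0_add_e1_square: "shift_product (e 0 + e 1) (e 0 + e 1) = 2 *\<^sub>C e 0"
  using S0 S1 by (simp add: shift_product_def bounded_clinear_simps[OF f] fe S_simps)

lemma bihypercyclic_shift_product:
  assumes "closure (C.span (range e)) = UNIV"
    and "countable D" "closure D = (UNIV :: 'a set)"
  shows "bihypercyclic shift_product"
proof -
  obtain y where y: "closure (range (\<lambda>(n, j). 2 ^ (n + j + 1) *\<^sub>C full_shift ((S ^^ Suc n) y))) = UNIV"
    by (rule full_shift_S_power_universal[OF assms])
  \<comment> \<open>The product rules need a start in the kernel of \<open>f 0\<close>. The
    correction is invisible to positive powers of \<open>S\<close>, because
    \<open>S (e 0) = 0\<close>.\<close>
  define y0 where "y0 = y - f 0 y *\<^sub>C e 0"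
  have S_y0: "(S ^^ Suc n) y0 = (S ^^ Suc n) y" for n
    unfolding y0_def funpow_Suc_right o_apply by (simp add: S_simps S0)
  have f_y0: "f 0 ((S ^^ n) y0) = 0" for n
    by (cases n) (simp_all add: y0_def fS bounded_clinear_simps[OF f] fe scaleC_complex_def)
  define M where "M = (\<Union>n. bilinear_iterate shift_product n (e 0 + e 1) y0)"
  have product_in_M: "shift_product z u \<in> M" if "z \<in> M" "u \<in> M" for z u
    using that unfolding M_def by (rule bilinear_iterates_closed)
  have "e 0 + e 1 \<in> bilinear_iterate shift_product 0 (e 0 + e 1) y0" "y0 \<in> bilinear_iterate shift_product 0 (e 0 + e 1) y0"
    by simp_all
  then have gens: "e 0 + e 1 \<in> M" "y0 \<in> M"
    unfolding M_def by blast+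
  have two_e0: "2 *\<^sub>C e 0 \<in> M"
    using product_in_M[OF gens(1) gens(1)] by (simp only: shift_product_e0_add_e1_square)
  have e0: "2 ^ Suc k *\<^sub>C e 0 \<in> M" for k
  proof (induction k)
    case 0
    show ?case using two_e0 by simp
  next
    case (Suc k)
    from product_in_M[OF two_e0 this] show ?case
      by (simp add: shift_product_e0_e0)
  qed
  \<comment> \<open>Multiplying by \<open>2 ^ Suc j *\<^sub>C e 0\<close> applies \<open>S\<close>
    once and contributes \<open>j + 1\<close> factors 2. Taking \<open>j = 0\<close> climbs from
    \<open>n\<close> to \<open>Suc n\<close>; a general \<open>j\<close> in the last application
    gives the surplus powers.\<close>
  have step: "2 ^ (n + j + 1) *\<^sub>C (S ^^ Suc n) y0 \<in> M" if "2 ^ n *\<^sub>C (S ^^ n) y0 \<in> M" for n j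
    using product_in_M[OF e0[of j] that]
    by (simp add: shift_product_e0_scaled f_y0 bounded_clinear_simps[OF f] scaleC_complex_def S_simps
        scaleC_scaleC power_add ac_simps)
  have "2 ^ n *\<^sub>C (S ^^ n) y0 \<in> M" for n
  proof (induction n)
    case 0
    then show ?case using gens by (simp add: scaleC_one)
  next
    case (Suc n)
    then show ?case using step[of n 0] by simp
  qed
  then have orbit: "2 ^ (n + j + 1) *\<^sub>C (S ^^ Suc n) y0 \<in> M" for n j
    by (rule step)
  \<comment> \<open>Multiplication by \<open>e 0 + e 1\<close> comes last, since
    \<open>full_shift\<close> may leave the kernel of \<open>f 0\<close>.\<close>
  have "2 ^ (n + j + 1) *\<^sub>C full_shift ((S ^^ Suc n) y) \<in> M" for n j
    using product_in_M[OF gens(1) orbit[of n j]] f_y0[of "Suc n"]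
    by (simp only: shift_product_e0_add_e1 bounded_clinear_simps[OF f] scaleC_complex_def mult_zero_right full_shift_simps S_y0)
  then have "range (\<lambda>(n, j). 2 ^ (n + j + 1) *\<^sub>C full_shift ((S ^^ Suc n) y)) \<subseteq> M"
    by auto
  then have "closure M = UNIV"
    using y closure_mono by blast
  then show ?thesis
    unfolding bihypercyclic_def M_def by blast
qed

end

theorem theorem4p4:
  assumes "infinite_dimensional TYPE('a::complex_banach)"
    and "separable_space (euclidean :: 'a topology)"
  shows "\<exists>A :: 'a \<Rightarrow> 'a \<Rightarrow> 'a.
           complex_bilinear A \<and>
           continuous_on UNIV (\<lambda>(x, y). A x y) \<and>
           (\<forall>x y. A x y = A y x) \<and>
           bihypercyclic A"
proof -
  obtain D :: "'a set" where D: "countable D" "closure D = UNIV"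
    using assms(2) by (auto simp: separable_space_def)
  obtain e :: "nat \<Rightarrow> 'a" and f :: "nat \<Rightarrow> 'a \<Rightarrow> complex"
    where f: "\<And>n. bounded_clinear (f n)" "\<And>m n. f m (e n) = (if m = n then 1 else 0)"
      and W: "closure (C.span (range e)) = UNIV"
    by (rule fundamental_biorthogonal_system[OF assms]) (rule that)
  obtain w S where wS: "\<And>n. w n \<noteq> 0" "bounded_clinear S" "S (e 0) = 0" "S (e 1) = 0"
    "\<And>n. S (e (n + 2)) = w n *\<^sub>C e (n + 1)" "\<And>x. f 0 (S x) = 0"
    by (rule shift_pair_exists[of f e, OF f]) (rule that)
  note facts = f wS
  show ?thesis
    using complex_bilinear_shift_product[OF facts] continuous_on_shift_product[OF facts] shift_product_commute[OF facts]
      bihypercyclic_shift_product[OF facts W D] by blast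
qed

end
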